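(* Let $N\ge2$, let $Y_1,\dots,Y_N\in\mathbb{P}_n$, and let $(X^\star,t^\star)$ be a solution to the problem $$\min_{X\succ0,\ t\in\mathbb{R}}\ t\quad\text{subject to}\quad e^{-t}Y_i\preceq X\preceq e^{t}Y_i\ \text{ for all } i=1,\dots,N.$$ If there are only two active matrices at $(X^\star,t^\star)$, i.e. exactly two indices $j\in\{1,\dots,N\}$ satisfy $d_\infty(X^\star,Y_j)=t^\star$, then the lower bound $l=\frac12\operatorname{diam}_\infty(\{Y_i\})$ is attained, i.e. $t^\star=l$.
   Context: $\mathbb{P}_n$ is the set of $n\times n$ complex Hermitian positive definite matrices; $X\succ0$ means $X\in\mathbb{P}_n$; $X\preceq Y$ means $Y-X$ is positive semidefinite. The Thompson metric on $\mathbb{P}_n$ is $d_\infty(A,B)=\|\log(A^{-1/2}BA^{-1/2})\|_\infty=\log\max\{\lambda_{\max}(AB^{-1}),\lambda_{\max}(BA^{-1})\}$. For $Y_1,\dots,Y_N\in\mathbb{P}_n$, the optimal value of the problem of minimizing $t$ over $X\succ0$ and $t\in\mathbb{R}$ subject to $e^{-t}Y_i\preceq X\preceq e^{t}Y_i$ for all $i=1,\dots,N$ equals $\min_{X\succ0}\max_i d_\infty(X,Y_i)$. $\operatorname{diam}_\infty(\{Y_i\})=\max_{i,j}d_\infty(Y_i,Y_j)$. A matrix $Y_j$ is called active at a solution $(X^\star,t^\star)$ if $d_\infty(X^\star,Y_j)=t^\star$. *)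

theory Defs
  imports "HOL-Analysis.Analysis"
begin

definition ctranspose :: "complex^'n^'m \<Rightarrow> complex^'m^'n" where
  "ctranspose A = (\<chi> i j. cnj (A $ j $ i))"

definition hermitian :: "complex^'n^'n \<Rightarrow> bool" where
  "hermitian A \<longleftrightarrow> ctranspose A = A"

definition unitary :: "complex^'n^'n \<Rightarrow> bool" where
  "unitary U \<longleftrightarrow> U ** ctranspose U = mat 1 \<and> ctranspose U ** U = mat 1"

text \<open>The inner product of the real inner product space \<^typ>\<open>complex^'n\<close> is the real part of
  the standard Hermitian one; for Hermitian \<open>A\<close> the form \<open>x\<^sup>* A x\<close> is real, so it
  equals \<open>x \<bullet> (A *v x)\<close>.\<close>

definition pos_semidef :: "complex^'n^'n \<Rightarrow> bool" where
  "pos_semidef A \<longleftrightarrow> hermitian A \<and> (\<forall>x. 0 \<le> x \<bullet> (A *v x))"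

definition pos_def :: "complex^'n^'n \<Rightarrow> bool" where
  "pos_def A \<longleftrightarrow> hermitian A \<and> (\<forall>x. x \<noteq> 0 \<longrightarrow> 0 < x \<bullet> (A *v x))"

definition loewner_le :: "complex^'n^'n \<Rightarrow> complex^'n^'n \<Rightarrow> bool" (infix \<open>\<preceq>\<close> 50) where
  "X \<preceq> Y \<longleftrightarrow> pos_semidef (Y - X)"

definition real_diag :: "('n \<Rightarrow> real) \<Rightarrow> complex^'n^'n" where
  "real_diag d = (\<chi> i j. if i = j then complex_of_real (d i) else 0)"

text \<open>Functional calculus: \<open>f(U diag(d) U\<^sup>*) = U diag(f \<circ> d) U\<^sup>*\<close>. For Hermitian \<open>A\<close> a
  unitary diagonalisation exists and the result does not depend on its choice. For other
  matrices the value is unspecified.\<close>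

definition matrix_fun :: "(real \<Rightarrow> real) \<Rightarrow> complex^'n^'n \<Rightarrow> complex^'n^'n" where
  "matrix_fun f A = (THE F. \<exists>U d. unitary U \<and> A = U ** real_diag d ** ctranspose U
     \<and> F = U ** real_diag (f \<circ> d) ** ctranspose U)"

definition matrix_log :: "complex^'n^'n \<Rightarrow> complex^'n^'n" where
  "matrix_log A = matrix_fun ln A"

definition matrix_inv_sqrt :: "complex^'n^'n \<Rightarrow> complex^'n^'n" where
  "matrix_inv_sqrt A = matrix_fun (\<lambda>x. x powr (- 1 / 2)) A"

text \<open>The norm in the Thompson metric is the spectral norm, i.e. the operator norm with respect
  to the Euclidean norm, and not the instance of \<^const>\<open>norm\<close> on matrices (which is the
  Frobenius norm).\<close>

definition spectral_norm :: "complex^'n^'n \<Rightarrow> real" where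
  "spectral_norm A = onorm (\<lambda>x. A *v x)"

definition thompson_dist :: "complex^'n^'n \<Rightarrow> complex^'n^'n \<Rightarrow> real" where
  "thompson_dist A B =
     spectral_norm (matrix_log (matrix_inv_sqrt A ** B ** matrix_inv_sqrt A))"

text \<open>The family \<open>Y\<^sub>1, \<dots>, Y\<^sub>N\<close> is given by the values of \<open>Y\<close> on \<open>{1..N}\<close>.\<close>

definition thompson_diam :: "nat \<Rightarrow> (nat \<Rightarrow> complex^'n^'n) \<Rightarrow> real" where
  "thompson_diam N Y = Max {thompson_dist (Y i) (Y j) | i j. i \<in> {1..N} \<and> j \<in> {1..N}}"

definition feasible :: "nat \<Rightarrow> (nat \<Rightarrow> complex^'n^'n) \<Rightarrow> complex^'n^'n \<Rightarrow> real \<Rightarrow> bool" where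
  "feasible N Y X t \<longleftrightarrow> pos_def X \<and>
     (\<forall>i\<in>{1..N}. exp (- t) *\<^sub>R Y i \<preceq> X \<and> X \<preceq> exp t *\<^sub>R Y i)"

definition is_solution :: "nat \<Rightarrow> (nat \<Rightarrow> complex^'n^'n) \<Rightarrow> complex^'n^'n \<Rightarrow> real \<Rightarrow> bool" where
  "is_solution N Y X t \<longleftrightarrow> feasible N Y X t \<and> (\<forall>X' t'. feasible N Y X' t' \<longrightarrow> t \<le> t')"

definition active :: "(nat \<Rightarrow> complex^'n^'n) \<Rightarrow> complex^'n^'n \<Rightarrow> real \<Rightarrow> nat \<Rightarrow> bool" where
  "active Y X t j \<longleftrightarrow> thompson_dist X (Y j) = t"

end

theory Submission
  imports Defs
begin

text \<open>The distance \<open>d\<close> is characterised by the Loewner order: \<open>d(A, B) \<le> r\<close> iff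
  \<open>e\<^sup>-\<^sup>r A \<preceq> B \<preceq> e\<^sup>r A\<close>. Hence the diameter is at most \<open>2t\<close>. If it were smaller, the two
  active matrices \<open>A\<close>, \<open>B\<close> would have a distance \<open>s < 2t\<close>, and
  \<open>M = (A + B) / (e\<^sup>s\<^sup>/\<^sup>2 + e\<^sup>-\<^sup>s\<^sup>/\<^sup>2)\<close> has distance at most \<open>s/2 < t\<close> to both. Moving from \<open>X\<close>
  a little along the line segment towards \<open>M\<close> strictly decreases the bound at the active matrices,
  because the order bounds are convex, and keeps the other distances below \<open>t\<close>. This contradicts
  the optimality of \<open>t\<close>.\<close>

section \<open>Adjoints\<close>

lemma inner_complex_Re: "x \<bullet> y = Re (cnj x * y)" for x y :: complex
  by (simp add: inner_complex_def)

lemma inner_adjoint: "x \<bullet> (M *v y) = (ctranspose M *v x) \<bullet> y"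
  for M :: "complex^'n^'m"
proof -
  have "x \<bullet> (M *v y) = (\<Sum>i\<in>UNIV. \<Sum>j\<in>UNIV. Re (cnj (x $ i) * (M $ i $ j * y $ j)))"
    by (simp only: inner_vec_def matrix_vector_mult_def vec_lambda_beta inner_complex_Re
        sum_distrib_left Re_sum)
  also have "\<dots> = (\<Sum>j\<in>UNIV. \<Sum>i\<in>UNIV. Re (cnj (x $ i) * (M $ i $ j * y $ j)))"
    by (rule sum.swap)
  also have "\<dots> = (ctranspose M *v x) \<bullet> y"
    by (simp only: inner_vec_def matrix_vector_mult_def vec_lambda_beta inner_complex_Re
        sum_distrib_right sum_distrib_left Re_sum ctranspose_def cnj_sum complex_cnj_mult
        complex_cnj_cnj mult_ac)
  finally show ?thesis .
qed

lemma ctranspose_mult: "ctranspose (A ** B) = ctranspose B ** ctranspose A"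
  by (simp add: ctranspose_def matrix_matrix_mult_def vec_eq_iff mult.commute)

lemma ctranspose_ctranspose [simp]: "ctranspose (ctranspose A) = A"
  by (simp add: ctranspose_def vec_eq_iff)

lemma ctranspose_add: "ctranspose (A + B) = ctranspose A + ctranspose B"
  by (simp add: ctranspose_def vec_eq_iff)

lemma ctranspose_diff: "ctranspose (A - B) = ctranspose A - ctranspose B"
  by (simp add: ctranspose_def vec_eq_iff)

lemma ctranspose_scaleR: "ctranspose (c *\<^sub>R A) = c *\<^sub>R ctranspose A"
  by (simp add: ctranspose_def vec_eq_iff)

lemma ctranspose_real_diag [simp]: "ctranspose (real_diag d) = real_diag d"
  by (auto simp: ctranspose_def real_diag_def vec_eq_iff)

lemma hermitian_inner: "hermitian A \<Longrightarrow> x \<bullet> (A *v y) = (A *v x) \<bullet> y"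
  by (simp add: inner_adjoint hermitian_def)

lemma matrix_vector_scalar: "A *v (c *s x) = c *s (A *v x)" for A :: "complex^'n^'m"
  by (simp add: matrix_vector_mult_def vec_eq_iff sum_distrib_left mult_ac)

lemma scaleR_matrix_vector: "(c *\<^sub>R A) *v x = c *\<^sub>R (A *v x)" for A :: "complex^'n^'m"
  by (simp add: matrix_vector_mult_def vec_eq_iff scaleR_sum_right)

lemma matrix_vector_scaleR: "A *v (c *\<^sub>R x) = c *\<^sub>R (A *v x)" for A :: "complex^'n^'m"
  by (simp add: matrix_vector_mult_def vec_eq_iff scaleR_sum_right)

section \<open>Spectral theorem for Hermitian matrices\<close>

text \<open>A maximiser of the Rayleigh quotient on an invariant subspace is an eigenvector.\<close>

lemma hermitian_eigenvector_in_subspace: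
  fixes A :: "complex^'n^'n"
  assumes "hermitian A" "subspace W" "\<And>x. x \<in> W \<Longrightarrow> A *v x \<in> W" "z \<in> W" "z \<noteq> 0"
  obtains x and l :: real where "x \<in> W" "norm x = 1" "A *v x = l *\<^sub>R x"
proof -
  let ?K = "sphere 0 1 \<inter> W"
  have "(1 / norm z) *\<^sub>R z \<in> ?K"
    using assms by (simp add: subspace_scale)
  moreover have "compact ?K"
    using assms(2) by (intro compact_Int_closed closed_subspace) auto
  moreover have "continuous_on ?K (\<lambda>x. x \<bullet> (A *v x))"
    by (intro continuous_intros matrix_vector_mult_linear_continuous_on)
  ultimately obtain x where x: "x \<in> ?K" and
    mx: "\<And>y. y \<in> ?K \<Longrightarrow> y \<bullet> (A *v y) \<le> x \<bullet> (A *v x)"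
    using continuous_attains_sup[of ?K "\<lambda>x. x \<bullet> (A *v x)"] by blast
  define l where "l = x \<bullet> (A *v x)"
  have nx: "norm x = 1" and xW: "x \<in> W" using x by auto
  then have xx: "x \<bullet> x = 1" by (simp add: dot_square_norm)
  have bound: "y \<bullet> (A *v y) \<le> l * (y \<bullet> y)" if "y \<in> W" for y
  proof (cases "y = 0")
    case False
    let ?u = "(1 / norm y) *\<^sub>R y"
    have "?u \<in> ?K" using that False assms(2) by (simp add: subspace_scale)
    from mx[OF this] have "?u \<bullet> (A *v ?u) \<le> l" by (simp add: l_def)
    then have "(y \<bullet> (A *v y)) / (norm y * norm y) \<le> l"
      by (simp add: matrix_vector_scaleR)
    with False show ?thesis
      by (simp add: divide_simps dot_square_norm power2_eq_square split: if_splits)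
  qed simp
  \<comment> \<open>\<open>w\<close> is the residual of the eigenvalue equation. Moving the
    maximiser \<open>x\<close> by \<open>e\<close> times \<open>w\<close> within \<open>W\<close>
    gives a quadratic inequality in \<open>e\<close> with linear coefficient
    \<open>2 * (w \<bullet> w)\<close>, valid for both signs of \<open>e\<close>, which forces
    \<open>w = 0\<close>.\<close>
  define w where "w = l *\<^sub>R x - A *v x"
  have wW: "w \<in> W" using xW assms unfolding w_def by (simp add: subspace_diff subspace_scale)
  define g where "g = l * (w \<bullet> w) - w \<bullet> (A *v w)"
  have sym: "x \<bullet> (A *v w) = w \<bullet> (A *v x)"
    using hermitian_inner[OF assms(1), of x w] by (simp add: inner_commute)
  have quad: "0 \<le> 2 * e * (w \<bullet> w) + e\<^sup>2 * g" for e :: real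
  proof -
    have "x + e *\<^sub>R w \<in> W" using xW wW assms(2) by (simp add: subspace_add subspace_scale)
    note b = bound[OF this]
    have 1: "(x + e *\<^sub>R w) \<bullet> (A *v (x + e *\<^sub>R w)) = l + 2 * e * (w \<bullet> (A *v x)) + e\<^sup>2 * (w \<bullet> (A *v w))"
      by (simp add: matrix_vector_right_distrib matrix_vector_scaleR inner_add_left inner_add_right sym
          l_def algebra_simps power2_eq_square)
    have 2: "l * ((x + e *\<^sub>R w) \<bullet> (x + e *\<^sub>R w)) = l + 2 * e * (l * (w \<bullet> x)) + e\<^sup>2 * (l * (w \<bullet> w))"
      using xx by (simp add: inner_add_left inner_add_right inner_commute
          algebra_simps power2_eq_square)
    have 3: "w \<bullet> w = l * (w \<bullet> x) - w \<bullet> (A *v x)"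
      by (subst (2) w_def) (simp add: inner_diff_right)
    from b 1 2 show ?thesis unfolding g_def by (subst 3) (simp add: algebra_simps)
  qed
  have "w \<bullet> w = 0"
  proof (rule ccontr)
    assume "w \<bullet> w \<noteq> 0"
    then have p: "w \<bullet> w > 0" by (metis inner_gt_zero_iff inner_eq_zero_iff)
    \<comment> \<open>A negative step, small enough that
      \<open>\<bar>e * g\<bar> \<le> w \<bullet> w\<close>, so that the linear term dominates the
      quadratic one. Adding 1 avoids division by zero.\<close>
    define e where "e = - (w \<bullet> w) / (\<bar>g\<bar> + 1)"
    have g: "0 < \<bar>g\<bar> + 1" by simp
    have "e < 0" using p unfolding e_def by (intro divide_neg_pos g) simp
    moreover have "e * g \<ge> - (w \<bullet> w)"
    proof -
      have "\<bar>e * g\<bar> \<le> w \<bullet> w"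
        using p g by (simp add: e_def abs_mult pos_divide_le_eq mult_left_mono)
      then show ?thesis by linarith
    qed
    ultimately have "e * (2 * (w \<bullet> w) + e * g) < 0"
      using p by (intro mult_neg_pos) linarith+
    with quad[of e] show False by (simp add: algebra_simps power2_eq_square)
  qed
  then have "A *v x = l *\<^sub>R x" by (simp add: w_def)
  with xW nx that show thesis by blast
qed

text \<open>Orthogonality for the Hermitian inner product, in terms of the real one:
  \<open>x \<bullet> y = 0\<close> and \<open>x \<bullet> \<i>y = 0\<close>.\<close>

lemma hermitian_orthonormal_eigenvectors:
  fixes A :: "complex^'n^'n" and I :: "'n set"
  assumes "hermitian A"
  shows "\<exists>v d. \<forall>i\<in>I. norm (v i) = 1 \<and> A *v v i = d i *\<^sub>R v i \<and>
    (\<forall>j\<in>I. i \<noteq> j \<longrightarrow> v i \<bullet> v j = 0 \<and> v i \<bullet> (\<i> *s v j) = 0)"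
  using finite[of I]
proof (induction I rule: finite_induct)
  case (insert k I)
  then obtain v :: "'n \<Rightarrow> complex^'n" and d :: "'n \<Rightarrow> real" where
    v: "\<And>i. i \<in> I \<Longrightarrow> norm (v i) = 1" "\<And>i. i \<in> I \<Longrightarrow> A *v v i = d i *\<^sub>R v i"
    "\<And>i j. i \<in> I \<Longrightarrow> j \<in> I \<Longrightarrow> i \<noteq> j \<Longrightarrow> v i \<bullet> v j = 0 \<and> v i \<bullet> (\<i> *s v j) = 0"
    by blast
  \<comment> \<open>Real orthogonality to a vector and to its multiple by the imaginary unit is
    Hermitian orthogonality to that vector. So \<open>W\<close> is the Hermitian complement of the
    eigenvectors found so far; it is invariant because \<open>A\<close> is self-adjoint and scales
    each element of \<open>T\<close>.\<close>
  define T where "T = v ` I \<union> (\<lambda>i. \<i> *s v i) ` I"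
  define W where "W = {x. \<forall>y\<in>T. y \<bullet> x = 0}"
  have AT: "\<exists>c::real. A *v y = c *\<^sub>R y" if "y \<in> T" for y
  proof -
    have "A *v (\<i> *s v i) = d i *\<^sub>R (\<i> *s v i)" if "i \<in> I" for i
      using v(2)[OF that] by (simp add: matrix_vector_scalar) (simp add: vec_eq_iff)
    with that v(2) show ?thesis unfolding T_def by blast
  qed
  \<comment> \<open>Each index contributes two real vectors and the real dimension is
    \<open>2 * CARD('n)\<close>. The index \<open>k\<close> outside \<open>I\<close> therefore
    leaves room for a nonzero vector of \<open>W\<close>.\<close>
  have "card T \<le> card I + card I"
    unfolding T_def
    by (rule order_trans[OF card_Un_le]) (intro add_mono card_image_le insert.hyps)
  moreover have "card I < CARD('n)"
    using insert.hyps by (metis UNIV_I finite psubset_card_mono psubsetI subset_UNIV)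
  ultimately have "dim (span T) < DIM(complex^'n)"
    using dim_le_card'[of T] insert.hyps by (simp add: T_def)
  from orthogonal_to_subspace_exists[of T] this
  obtain z where z: "z \<noteq> 0" "\<And>y. y \<in> span T \<Longrightarrow> orthogonal z y"
    by (metis dim_span)
  have zW: "z \<in> W" using z(2) by (auto simp: W_def orthogonal_def inner_commute span_base)
  have sub: "subspace W"
    by (auto simp: W_def subspace_def inner_add_right)
  have inv: "A *v x \<in> W" if "x \<in> W" for x
    unfolding W_def
  proof safe
    fix y assume y: "y \<in> T"
    then obtain c :: real where "A *v y = c *\<^sub>R y" using AT by blast
    then have "y \<bullet> (A *v x) = c * (y \<bullet> x)"
      by (simp add: hermitian_inner[OF assms])
    then show "y \<bullet> (A *v x) = 0" using that y by (simp add: W_def)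
  qed
  obtain x and l :: real where x: "x \<in> W" "norm x = 1" "A *v x = l *\<^sub>R x"
    using hermitian_eigenvector_in_subspace[OF assms sub inv zW z(1)] by blast
  have i_swap: "a \<bullet> (\<i> *s b) = - ((\<i> *s a) \<bullet> b)" for a b :: "complex^'n"
    by (simp add: inner_vec_def inner_complex_def sum_negf[symmetric] algebra_simps)
  have xo: "x \<bullet> v i = 0" "v i \<bullet> x = 0" "x \<bullet> (\<i> *s v i) = 0" "v i \<bullet> (\<i> *s x) = 0"
    if "i \<in> I" for i
  proof -
    have "v i \<bullet> x = 0" "(\<i> *s v i) \<bullet> x = 0"
      using x(1) that by (auto simp: W_def T_def)
    then show "x \<bullet> v i = 0" "v i \<bullet> x = 0" "x \<bullet> (\<i> *s v i) = 0" "v i \<bullet> (\<i> *s x) = 0"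
      using i_swap[of "v i" x] by (simp_all add: inner_commute)
  qed
  have ne: "i \<noteq> k" if "i \<in> I" for i using that insert.hyps by auto
  show ?case
    by (rule exI[of _ "v(k := x)"], rule exI[of _ "d(k := l)"]) (use v x xo ne in auto)
qed simp

section \<open>Real diagonal matrices and unitary diagonalisation\<close>

lemma real_diag_mult_vec: "(real_diag d *v x) $ i = of_real (d i) * x $ i"
  by (simp add: matrix_vector_mult_def real_diag_def if_distrib[of "\<lambda>a. a * z" for z] cong: if_cong)

lemma mult_real_diag: "(M ** real_diag d) $ i $ j = M $ i $ j * of_real (d j)"
  by (simp add: matrix_matrix_mult_def real_diag_def if_distrib[of "\<lambda>a. z * a" for z] cong: if_cong)

lemma real_diag_mult: "(real_diag d ** M) $ i $ j = of_real (d i) * M $ i $ j"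
  by (simp add: matrix_matrix_mult_def real_diag_def if_distrib[of "\<lambda>a. a * z" for z] cong: if_cong)

lemma real_diag_mult_real_diag: "real_diag d ** real_diag e = real_diag (\<lambda>i. d i * e i)"
  by (simp add: vec_eq_iff real_diag_mult) (simp add: real_diag_def)

lemma real_diag_one: "real_diag (\<lambda>_. 1) = mat 1"
  by (simp add: real_diag_def mat_def vec_eq_iff)

lemma unitary_cancel:
  assumes "unitary U"
  shows "U ** (ctranspose U ** M) = M" "ctranspose U ** (U ** M) = M"
    "ctranspose U *v (U *v x) = x" "U *v (ctranspose U *v x) = x"
  using assms by (simp_all add: unitary_def matrix_mul_assoc matrix_vector_mul_assoc)

theorem hermitian_spectral_decomposition:
  fixes A :: "complex^'n^'n"
  assumes "hermitian A"
  obtains U d where "unitary U" "A = U ** real_diag d ** ctranspose U"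
proof -
  obtain v :: "'n \<Rightarrow> complex^'n" and d :: "'n \<Rightarrow> real" where
    v: "\<And>i. norm (v i) = 1" "\<And>i. A *v v i = d i *\<^sub>R v i"
    "\<And>i j. i \<noteq> j \<Longrightarrow> v i \<bullet> v j = 0 \<and> v i \<bullet> (\<i> *s v j) = 0"
    using hermitian_orthonormal_eigenvectors[OF assms, of UNIV] by auto
  define U :: "complex^'n^'n" where "U = (\<chi> a i. v i $ a)"
  \<comment> \<open>Real and imaginary part of the Hermitian product, written with the real one. The
    two real orthogonality relations thus give the entries of
    \<open>ctranspose U ** U\<close>.\<close>
  have prod: "(\<Sum>a\<in>UNIV. cnj (x $ a) * y $ a) = Complex (x \<bullet> y) (- (x \<bullet> (\<i> *s y)))"
    for x y :: "complex^'n"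
    by (simp add: complex_eq_iff inner_vec_def inner_complex_def sum_negf[symmetric] algebra_simps)
  have "v i \<bullet> (\<i> *s v i) = 0" for i
    by (simp add: inner_vec_def inner_complex_def algebra_simps)
  then have UU: "ctranspose U ** U = mat 1"
    using v(1,3)
    by (auto simp: vec_eq_iff matrix_matrix_mult_def ctranspose_def U_def prod mat_def
        dot_square_norm complex_eq_iff)
  then have un: "unitary U"
    by (simp add: unitary_def matrix_left_right_inverse)
  have "A ** U = U ** real_diag d"
  proof -
    have "(A ** U) $ a $ i = (A *v v i) $ a" for a i
      by (simp add: matrix_matrix_mult_def matrix_vector_mult_def U_def)
    then show ?thesis
      by (simp add: vec_eq_iff v(2) mult_real_diag) (simp add: U_def scaleR_conv_of_real mult.commute)
  qed
  then have "A = U ** real_diag d ** ctranspose U"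
    using un by (metis unitary_def matrix_mul_assoc matrix_mul_rid)
  with un that show thesis by blast
qed

section \<open>Functional calculus\<close>

text \<open>This discharges the uniqueness demanded by \<open>THE\<close>. The unitary matrix
  relating two diagonalisations intertwines the diagonal matrices, hence also their images under
  \<open>f\<close>, as these depend only on the eigenvalues.\<close>

lemma matrix_fun_eq:
  fixes U :: "complex^'n^'n"
  assumes U: "unitary U"
  shows "matrix_fun f (U ** real_diag d ** ctranspose U) = U ** real_diag (f \<circ> d) ** ctranspose U"
  unfolding matrix_fun_def
proof (rule the_equality)
  fix F
  assume "\<exists>V e. unitary V \<and> U ** real_diag d ** ctranspose U = V ** real_diag e ** ctranspose V
    \<and> F = V ** real_diag (f \<circ> e) ** ctranspose V"
  then obtain V e where V: "unitary V"
    and eq: "U ** real_diag d ** ctranspose U = V ** real_diag e ** ctranspose V"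
    and F: "F = V ** real_diag (f \<circ> e) ** ctranspose V" by blast
  \<comment> \<open>The entries of \<open>W = V\<^sup>*U\<close> vanish except where the eigenvalues agree.\<close>
  define W where "W = ctranspose V ** U"
  have "ctranspose V ** (U ** real_diag d ** ctranspose U) ** U = W ** real_diag d"
    using U by (simp add: W_def matrix_mul_assoc[symmetric] unitary_def)
  moreover have "ctranspose V ** (V ** real_diag e ** ctranspose V) ** U = real_diag e ** W"
    using V by (simp add: W_def matrix_mul_assoc[symmetric] unitary_cancel)
  ultimately have WD: "W ** real_diag d = real_diag e ** W" using eq by simp
  have "W $ i $ j * of_real (d j) = of_real (e i) * W $ i $ j" for i j
    using arg_cong[OF WD, of "\<lambda>M. M $ i $ j"] by (simp add: mult_real_diag real_diag_mult)
  then have "W $ i $ j = 0 \<or> d j = e i" for i j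
    by (metis mult.commute mult_cancel_left of_real_eq_iff)
  then have "W ** real_diag (f \<circ> d) = real_diag (f \<circ> e) ** W"
    by (auto simp: vec_eq_iff mult_real_diag real_diag_mult) (metis mult.commute mult_zero_right)
  then have "V ** (W ** real_diag (f \<circ> d)) ** ctranspose U = V ** (real_diag (f \<circ> e) ** W) ** ctranspose U"
    by simp
  moreover have "V ** (W ** real_diag (f \<circ> d)) ** ctranspose U = U ** real_diag (f \<circ> d) ** ctranspose U"
    using V by (simp add: W_def matrix_mul_assoc[symmetric] unitary_cancel)
  moreover have "V ** (real_diag (f \<circ> e) ** W) ** ctranspose U = F"
    using U by (simp add: W_def F matrix_mul_assoc[symmetric] unitary_def)
  ultimately show "F = U ** real_diag (f \<circ> d) ** ctranspose U" by simp
qed (use U in blast)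

section \<open>Quadratic form and spectral norm of a diagonalised matrix\<close>

lemma inner_real_diag: "x \<bullet> (real_diag d *v x) = (\<Sum>i\<in>UNIV. d i * (norm (x $ i))\<^sup>2)"
proof -
  have "a \<bullet> (of_real c * a) = c * (norm a)\<^sup>2" for a :: complex and c
    unfolding cmod_power2 by (simp add: inner_complex_def power2_eq_square algebra_simps)
  then show ?thesis
    by (simp add: inner_vec_def real_diag_mult_vec)
qed

lemma inner_unitary_diag:
  "x \<bullet> ((U ** real_diag d ** ctranspose U) *v x)
     = (\<Sum>i\<in>UNIV. d i * (norm ((ctranspose U *v x) $ i))\<^sup>2)"
  by (simp only: inner_adjoint[of x U] matrix_vector_mul_assoc[symmetric] inner_real_diag)

lemma norm_unitary: "unitary U \<Longrightarrow> norm (U *v x) = norm x"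
  by (simp add: norm_eq_sqrt_inner inner_adjoint unitary_cancel)

lemma unitary_ctranspose: "unitary U \<Longrightarrow> unitary (ctranspose U)"
  by (simp add: unitary_def)

lemma real_diag_axis: "real_diag d *v axis i 1 = d i *\<^sub>R axis i 1"
  by (simp add: vec_eq_iff real_diag_mult_vec axis_def of_real_def)

text \<open>The columns of \<open>U\<close> are unit eigenvectors and detect each eigenvalue.
  Conversely, unitary maps preserve the norm, so a coordinatewise comparison in the eigenbasis
  suffices.\<close>

lemma spectral_norm_unitary_diag_le_iff:
  assumes U: "unitary U"
  shows "spectral_norm (U ** real_diag d ** ctranspose U) \<le> r \<longleftrightarrow> (\<forall>i. \<bar>d i\<bar> \<le> r)"
proof
  let ?A = "U ** real_diag d ** ctranspose U"
  assume le: "spectral_norm ?A \<le> r"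
  show "\<forall>i. \<bar>d i\<bar> \<le> r"
  proof
    fix i
    let ?u = "U *v axis i 1"
    have 1: "norm ?u = 1" using U by (simp add: norm_unitary)
    have "?A *v ?u = d i *\<^sub>R ?u"
      by (simp add: matrix_vector_mul_assoc[symmetric] unitary_cancel[OF U] real_diag_axis
          matrix_vector_scaleR)
    then have "\<bar>d i\<bar> = norm (?A *v ?u)" using 1 by simp
    also have "\<dots> \<le> spectral_norm ?A"
      using onorm[OF matrix_vector_mul_bounded_linear, of ?A ?u] 1
      by (simp add: spectral_norm_def)
    finally show "\<bar>d i\<bar> \<le> r" using le by simp
  qed
next
  let ?A = "U ** real_diag d ** ctranspose U"
  assume le: "\<forall>i. \<bar>d i\<bar> \<le> r"
  show "spectral_norm ?A \<le> r"
    unfolding spectral_norm_def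
  proof (rule onorm_le)
    fix x
    let ?y = "ctranspose U *v x"
    have r: "0 \<le> r" using le abs_ge_zero order_trans by blast
    have "norm (?A *v x) = norm (real_diag d *v ?y)"
      using U by (simp add: matrix_vector_mul_assoc[symmetric] norm_unitary)
    also have "\<dots> \<le> norm (r *\<^sub>R ?y)"
      unfolding norm_vec_def
      by (rule L2_set_mono) (use le r in \<open>auto simp: real_diag_mult_vec norm_mult intro!: mult_right_mono\<close>)
    also have "\<dots> = r * norm x"
      using U r by (simp add: norm_unitary unitary_ctranspose)
    finally show "norm (?A *v x) \<le> r * norm x" .
  qed
qed

section \<open>Loewner order and the Thompson metric\<close>

lemma pos_def_hermitian: "pos_def A \<Longrightarrow> hermitian A"
  by (simp add: pos_def_def)

lemma loewner_le_iff:
  assumes "hermitian A" "hermitian B"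
  shows "A \<preceq> B \<longleftrightarrow> (\<forall>x. x \<bullet> (A *v x) \<le> x \<bullet> (B *v x))"
  using assms
  by (simp add: loewner_le_def pos_semidef_def hermitian_def ctranspose_diff
      matrix_vector_mult_diff_rdistrib inner_diff_right)

lemma hermitian_scaleR: "hermitian A \<Longrightarrow> hermitian (c *\<^sub>R A)"
  by (simp add: hermitian_def ctranspose_scaleR)

lemma pos_def_add: "pos_def A \<Longrightarrow> pos_def B \<Longrightarrow> pos_def (A + B)"
  by (simp add: pos_def_def hermitian_def ctranspose_add matrix_vector_mult_add_rdistrib
      inner_add_right add_pos_pos)

lemma pos_def_scaleR: "0 < c \<Longrightarrow> pos_def A \<Longrightarrow> pos_def (c *\<^sub>R A)"
  by (simp add: pos_def_def hermitian_def ctranspose_scaleR scaleR_matrix_vector)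

lemma unitary_diag_bounds_iff:
  assumes U: "unitary U"
  shows "(\<forall>x. a * (x \<bullet> x) \<le> x \<bullet> ((U ** real_diag d ** ctranspose U) *v x)
      \<and> x \<bullet> ((U ** real_diag d ** ctranspose U) *v x) \<le> b * (x \<bullet> x))
    \<longleftrightarrow> (\<forall>i. a \<le> d i \<and> d i \<le> b)"
    (is "?L \<longleftrightarrow> ?R")
proof
  assume L: ?L
  show ?R
  proof
    fix i
    let ?u = "U *v axis i 1"
    have "?u \<bullet> ?u = 1" using U norm_unitary[OF U, of "axis i 1"] by (simp add: dot_square_norm)
    moreover have "(U ** real_diag d ** ctranspose U) *v ?u = d i *\<^sub>R ?u"
      by (simp add: matrix_vector_mul_assoc[symmetric] unitary_cancel[OF U] real_diag_axis
          matrix_vector_scaleR)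
    ultimately show "a \<le> d i \<and> d i \<le> b" using L[rule_format, of ?u] by simp
  qed
next
  assume R: ?R
  have xx: "x \<bullet> x = (\<Sum>i\<in>UNIV. (norm ((ctranspose U *v x) $ i))\<^sup>2)" for x
  proof -
    have "x \<bullet> x = (ctranspose U *v x) \<bullet> (ctranspose U *v x)"
      using norm_unitary[OF unitary_ctranspose[OF U], of x] by (simp add: dot_square_norm)
    then show ?thesis by (simp add: inner_vec_def dot_square_norm)
  qed
  show ?L
    unfolding inner_unitary_diag xx sum_distrib_left
    using R by (auto intro!: sum_mono mult_right_mono)
qed

text \<open>The logarithm of \<open>C\<close>, the conjugate of \<open>B\<close> by the inverse root
  of \<open>A\<close>, has norm at most \<open>r\<close> iff all eigenvalues of \<open>C\<close> lie
  between \<open>exp (- r)\<close> and \<open>exp r\<close>. This bounds the form of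
  \<open>C\<close> by multiples of the squared norm, and undoing the conjugation gives the forms of
  \<open>A\<close> and \<open>B\<close>. All later facts about the distance rest on this
  criterion.\<close>

theorem thompson_dist_le_iff:
  fixes A B :: "complex^'n^'n"
  assumes A: "pos_def A" and B: "pos_def B"
  shows "thompson_dist A B \<le> r \<longleftrightarrow>
    (\<forall>x. exp (- r) * (x \<bullet> (A *v x)) \<le> x \<bullet> (B *v x) \<and> x \<bullet> (B *v x) \<le> exp r * (x \<bullet> (A *v x)))"
proof -
  obtain U d where U: "unitary U" and Ad: "A = U ** real_diag d ** ctranspose U"
    using hermitian_spectral_decomposition[OF pos_def_hermitian[OF A]] by blast
  have eig_pos: "0 < e i" if "pos_def M" "unitary V" "M = V ** real_diag e ** ctranspose V"
    for M V :: "complex^'n^'n" and e i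
  proof -
    let ?u = "V *v axis i 1"
    have n: "norm ?u = 1" using that by (simp add: norm_unitary)
    have "M *v ?u = e i *\<^sub>R ?u"
      using that by (simp add: matrix_vector_mul_assoc[symmetric] unitary_cancel real_diag_axis
          matrix_vector_scaleR)
    moreover have "?u \<noteq> 0" using n by force
    ultimately have "0 < e i * (?u \<bullet> ?u)" using that(1) by (metis pos_def_def inner_scaleR_right)
    then show ?thesis using n by (simp add: dot_square_norm)
  qed
  have dpos: "0 < d i" for i using eig_pos[OF A U Ad] .
  \<comment> \<open>\<open>S\<close> and \<open>R\<close> are the powers of \<open>A\<close> with
    exponents -1/2 and 1/2. \<open>R\<close> inverts \<open>S\<close> and squares to
    \<open>A\<close>, which permits the final substitution.\<close>
  define S where "S = U ** real_diag (\<lambda>i. d i powr (- 1 / 2)) ** ctranspose U"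
  define R where "R = U ** real_diag (\<lambda>i. d i powr (1 / 2)) ** ctranspose U"
  have S: "matrix_inv_sqrt A = S"
    unfolding matrix_inv_sqrt_def Ad matrix_fun_eq[OF U] S_def by (simp add: comp_def)
  have conj_mult: "(U ** real_diag f ** ctranspose U) ** (U ** real_diag g ** ctranspose U)
      = U ** real_diag (\<lambda>i. f i * g i) ** ctranspose U" for f g
    by (simp add: matrix_mul_assoc[symmetric] unitary_cancel[OF U])
      (simp add: matrix_mul_assoc real_diag_mult_real_diag[symmetric])
  have UU: "U ** ctranspose U = mat 1" using U by (simp add: unitary_def)
  have SR: "S ** R = mat 1" "R ** S = mat 1"
    unfolding S_def R_def conj_mult using dpos
    by (simp_all add: powr_add[symmetric] real_diag_one UU less_imp_neq[symmetric])
  have RR: "R ** R = A"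
    unfolding R_def conj_mult Ad using dpos
    by (simp add: powr_add[symmetric] less_imp_le)
  have hS: "ctranspose S = S" and hR: "ctranspose R = R"
    by (simp_all add: S_def R_def ctranspose_mult matrix_mul_assoc)
  define C where "C = S ** B ** S"
  have qC: "x \<bullet> (C *v x) = (S *v x) \<bullet> (B *v (S *v x))" for x
    by (simp only: C_def inner_adjoint[of x S] hS matrix_vector_mul_assoc[symmetric])
  have qA: "y \<bullet> (A *v y) = (R *v y) \<bullet> (R *v y)" for y
    by (simp only: RR[symmetric] inner_adjoint[of y R] hR matrix_vector_mul_assoc[symmetric])
  have RSx: "R *v (S *v x) = x" "S *v (R *v x) = x" for x
    using SR by (simp_all add: matrix_vector_mul_assoc)
  have C: "pos_def C"
    unfolding pos_def_def
  proof safe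
    have "ctranspose B = B" using B by (simp add: pos_def_def hermitian_def)
    then show "hermitian C" by (simp add: hermitian_def C_def ctranspose_mult hS matrix_mul_assoc)
    fix x :: "complex^'n" assume "x \<noteq> 0"
    then have "S *v x \<noteq> 0" using RSx(1)[of x] by auto
    then show "0 < x \<bullet> (C *v x)" using B by (simp add: qC pos_def_def)
  qed
  obtain V e where V: "unitary V" and Ce: "C = V ** real_diag e ** ctranspose V"
    using hermitian_spectral_decomposition[OF pos_def_hermitian[OF C]] by blast
  have epos: "0 < e i" for i using eig_pos[OF C V Ce] .
  have "thompson_dist A B = spectral_norm (V ** real_diag (ln \<circ> e) ** ctranspose V)"
    by (simp add: thompson_dist_def matrix_log_def S C_def[symmetric]) (simp add: Ce matrix_fun_eq[OF V])
  then have "thompson_dist A B \<le> r \<longleftrightarrow> (\<forall>i. \<bar>ln (e i)\<bar> \<le> r)"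
    by (simp add: spectral_norm_unitary_diag_le_iff[OF V])
  also have "\<dots> \<longleftrightarrow> (\<forall>i. exp (- r) \<le> e i \<and> e i \<le> exp r)"
  proof -
    have "\<bar>ln (e i)\<bar> \<le> r \<longleftrightarrow> exp (- r) \<le> e i \<and> e i \<le> exp r" for i
      using epos[of i] by (metis abs_le_iff exp_le_cancel_iff exp_ln minus_le_iff)
    then show ?thesis by simp
  qed
  also have "\<dots> \<longleftrightarrow> (\<forall>x. exp (- r) * (x \<bullet> x) \<le> x \<bullet> (C *v x) \<and> x \<bullet> (C *v x) \<le> exp r * (x \<bullet> x))"
    unfolding Ce unitary_diag_bounds_iff[OF V] ..
  \<comment> \<open>Substitute \<open>x = R *v y\<close>; by \<open>RSx\<close> this is a bijection,
    so both quantifiers range over all vectors.\<close>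
  also have "\<dots> \<longleftrightarrow> (\<forall>y. exp (- r) * (y \<bullet> (A *v y)) \<le> y \<bullet> (B *v y)
      \<and> y \<bullet> (B *v y) \<le> exp r * (y \<bullet> (A *v y)))"
    unfolding qA qC by (metis RSx)
  finally show ?thesis .
qed

text \<open>The criterion is symmetric in the two matrices for each vector separately, and reals
  with the same upper bounds coincide.\<close>

lemma thompson_dist_commute:
  assumes "pos_def A" "pos_def B"
  shows "thompson_dist A B = thompson_dist B A"
proof -
  have "exp (- r) * a \<le> b \<and> b \<le> exp r * a \<longleftrightarrow> exp (- r) * b \<le> a \<and> a \<le> exp r * b"
    for r a b :: real
    by (auto simp: exp_minus field_simps)
  then have "thompson_dist A B \<le> r \<longleftrightarrow> thompson_dist B A \<le> r" for r
    using assms by (simp add: thompson_dist_le_iff)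
  then show ?thesis by (meson antisym order_refl)
qed

lemma thompson_dist_le_iff_loewner:
  assumes "pos_def A" "pos_def B"
  shows "thompson_dist A B \<le> r \<longleftrightarrow> exp (- r) *\<^sub>R A \<preceq> B \<and> B \<preceq> exp r *\<^sub>R A"
  using assms
  by (auto simp: thompson_dist_le_iff loewner_le_iff hermitian_scaleR pos_def_hermitian
      scaleR_matrix_vector)

section \<open>Strict distance bounds along a line segment\<close>

lemma thompson_dist_lessI:
  assumes A: "pos_def A" and B: "pos_def B" and "a < exp t" "exp (- t) < b"
    and bd: "\<And>x. b * (x \<bullet> (A *v x)) \<le> x \<bullet> (B *v x)"
    "\<And>x. x \<bullet> (B *v x) \<le> a * (x \<bullet> (A *v x))"
  shows "thompson_dist A B < t"
proof -
  \<comment> \<open>Any nonzero vector would do: comparing the positive forms at it gives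
    \<open>a > 0\<close>, so that \<open>ln a\<close> is meaningful.\<close>
  let ?u = "axis undefined 1 :: complex^'n"
  have "?u \<noteq> 0" by (simp add: axis_eq_0_iff)
  then have "0 < ?u \<bullet> (A *v ?u)" "0 < ?u \<bullet> (B *v ?u)" using A B unfolding pos_def_def by blast+
  then have a: "0 < a" using bd(2)[of ?u] by (smt (verit) mult_nonpos_nonneg)
  have b: "0 < b" using assms(4) exp_gt_zero less_trans by blast
  \<comment> \<open>The least radius with \<open>a \<le> exp r\<close> and
    \<open>exp (- r) \<le> b\<close>. It lies strictly below \<open>t\<close>, which turns the
    non-strict criterion into a strict bound.\<close>
  define r where "r = max (ln a) (- ln b)"
  have "ln a < t" using a assms(3) by (metis exp_less_cancel_iff exp_ln)
  moreover have "- t < ln b" using b assms(4) by (metis exp_less_cancel_iff exp_ln)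
  ultimately have "r < t" by (simp add: r_def)
  have ar: "a \<le> exp r" using a by (metis exp_le_cancel_iff exp_ln max.cobounded1 r_def)
  have "- r \<le> ln b" by (simp add: r_def)
  then have br: "exp (- r) \<le> b" using b by (metis exp_le_cancel_iff exp_ln)
  have q: "0 \<le> x \<bullet> (A *v x)" for x
    using A by (cases "x = 0") (auto simp: pos_def_def less_imp_le)
  have "thompson_dist A B \<le> r"
    unfolding thompson_dist_le_iff[OF A B]
    using bd mult_right_mono[OF ar q] mult_right_mono[OF br q] by (meson order_trans)
  with \<open>r < t\<close> show ?thesis by simp
qed

text \<open>The quadratic form is linear in the matrix, so the factors comparing \<open>X\<close>
  and \<open>M\<close> with \<open>Y\<close> are averaged with weights \<open>1 - e\<close> and
  \<open>e\<close>.\<close>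

lemma thompson_dist_segment_less:
  assumes Y: "pos_def Y" and X: "pos_def X" and M: "pos_def M" and e: "0 < e" "e < 1"
    and "(1 - e) * exp (thompson_dist Y X) + e * exp (thompson_dist Y M) < exp t"
    and "exp (- t) < (1 - e) * exp (- thompson_dist Y X) + e * exp (- thompson_dist Y M)"
  shows "thompson_dist Y ((1 - e) *\<^sub>R X + e *\<^sub>R M) < t"
proof (rule thompson_dist_lessI[OF Y _ assms(6,7)])
  show "pos_def ((1 - e) *\<^sub>R X + e *\<^sub>R M)"
    using e X M by (intro pos_def_add pos_def_scaleR) auto
  fix x
  have X': "exp (- thompson_dist Y X) * (x \<bullet> (Y *v x)) \<le> x \<bullet> (X *v x)"
    "x \<bullet> (X *v x) \<le> exp (thompson_dist Y X) * (x \<bullet> (Y *v x))"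
    using thompson_dist_le_iff[OF Y X] by blast+
  have M': "exp (- thompson_dist Y M) * (x \<bullet> (Y *v x)) \<le> x \<bullet> (M *v x)"
    "x \<bullet> (M *v x) \<le> exp (thompson_dist Y M) * (x \<bullet> (Y *v x))"
    using thompson_dist_le_iff[OF Y M] by blast+
  have eq: "x \<bullet> (((1 - e) *\<^sub>R X + e *\<^sub>R M) *v x) = (1 - e) * (x \<bullet> (X *v x)) + e * (x \<bullet> (M *v x))"
    by (simp add: matrix_vector_mult_add_rdistrib scaleR_matrix_vector inner_add_right)
  have "0 \<le> 1 - e" "0 \<le> e" using e by auto
  note mono = add_mono[OF mult_left_mono[OF _ this(1)] mult_left_mono[OF _ this(2)]]
  show "((1 - e) * exp (- thompson_dist Y X) + e * exp (- thompson_dist Y M)) * (x \<bullet> (Y *v x))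
      \<le> x \<bullet> (((1 - e) *\<^sub>R X + e *\<^sub>R M) *v x)"
    using mono[OF X'(1) M'(1)] unfolding eq by (simp add: distrib_right mult.assoc)
  show "x \<bullet> (((1 - e) *\<^sub>R X + e *\<^sub>R M) *v x)
      \<le> ((1 - e) * exp (thompson_dist Y X) + e * exp (thompson_dist Y M)) * (x \<bullet> (Y *v x))"
    using mono[OF X'(2) M'(2)] unfolding eq by (simp add: distrib_right mult.assoc)
qed

text \<open>Here \<open>p\<close> and \<open>m\<close> stand for the distances of a data matrix to
  \<open>X\<close> and to \<open>M\<close>. If \<open>p < t\<close>, continuity at
  \<open>e = 0\<close> suffices, whatever \<open>m\<close> is; if \<open>p = t\<close>, then
  \<open>m < t\<close> and every positive \<open>e\<close> gives strict improvement. The filter form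
  lets finitely many such conditions be combined.\<close>

lemma eventually_segment_bounds:
  fixes p m t :: real
  assumes "p \<le> t" "p < t \<or> m < t"
  shows "\<forall>\<^sub>F e in at_right 0. (1 - e) * exp p + e * exp m < exp t \<and>
    exp (- t) < (1 - e) * exp (- p) + e * exp (- m)"
proof (cases "p < t")
  case True
  have "((\<lambda>e. (1 - e) * exp p + e * exp m) \<longlongrightarrow> (1 - 0) * exp p + 0 * exp m) (at_right 0)"
    "((\<lambda>e. (1 - e) * exp (- p) + e * exp (- m)) \<longlongrightarrow> (1 - 0) * exp (- p) + 0 * exp (- m)) (at_right 0)"
    by (intro tendsto_intros)+
  with True show ?thesis
    by (intro eventually_conj order_tendstoD[where y = "(1 - 0) * exp p + 0 * exp m"]
        order_tendstoD[where y = "(1 - 0) * exp (- p) + 0 * exp (- m)"]) auto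
next
  case False
  with assms have [simp]: "p = t" and m: "m < t" by auto
  have "(1 - e) * exp p + e * exp m < exp t \<and> exp (- t) < (1 - e) * exp (- p) + e * exp (- m)"
    if "0 < e" for e :: real
  proof -
    have "e * exp m < e * exp t" "e * exp (- t) < e * exp (- m)"
      using m that by auto
    then show ?thesis by (simp add: algebra_simps)
  qed
  then show ?thesis by (auto simp: eventually_at_filter)
qed

text \<open>A linear substitute for the geometric mean. With \<open>u = exp (s / 2)\<close> the
  divisor is \<open>u + 1 / u\<close>, chosen because \<open>1 + u * u\<close> is \<open>u\<close>
  times it and \<open>1 + 1 / (u * u)\<close> is \<open>1 / u\<close> times it.\<close>

definition thompson_mid :: "real \<Rightarrow> complex^'n^'n \<Rightarrow> complex^'n^'n \<Rightarrow> complex^'n^'n" where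
  "thompson_mid s A B = (1 / (exp (s / 2) + exp (- (s / 2)))) *\<^sub>R (A + B)"

lemma pos_def_thompson_mid: "pos_def A \<Longrightarrow> pos_def B \<Longrightarrow> pos_def (thompson_mid s A B)"
  unfolding thompson_mid_def by (intro pos_def_scaleR pos_def_add) (auto simp: add_pos_pos)

lemma thompson_mid_commute: "thompson_mid s A B = thompson_mid s B A"
  by (simp add: thompson_mid_def add.commute)

text \<open>Adding the form of \<open>A\<close> to the bounds on \<open>B\<close> yields the factors
  \<open>1 + 1 / (u * u)\<close> and \<open>1 + u * u\<close>, which the divisor reduces to
  \<open>1 / u\<close> and \<open>u\<close>. By symmetry of the construction the bound for
  \<open>A\<close> also serves for \<open>B\<close>.\<close>

lemma thompson_dist_mid:
  fixes A B :: "complex^'n^'n"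
  assumes A: "pos_def A" and B: "pos_def B" and s: "thompson_dist A B \<le> s"
  shows "thompson_dist A (thompson_mid s A B) \<le> s / 2"
  unfolding thompson_dist_le_iff[OF A pos_def_thompson_mid[OF A B]]
proof (intro allI)
  fix x
  define q where "q M = x \<bullet> (M *v x)" for M :: "complex^'n^'n"
  define u where "u = exp (s / 2)"
  have u: "0 < u" by (simp add: u_def)
  have es: "exp s = u * u" "exp (- s) = 1 / (u * u)" "exp (- (s / 2)) = 1 / u"
    by (simp_all add: u_def exp_minus exp_add[symmetric] divide_simps)
  have AB: "q A / (u * u) \<le> q B" "q B \<le> u * u * q A"
    using s unfolding thompson_dist_le_iff[OF A B] q_def es by (simp_all add: es)
  have mid: "q (thompson_mid s A B) = (q A + q B) / (u + 1 / u)"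
    by (simp add: q_def thompson_mid_def scaleR_matrix_vector matrix_vector_mult_add_rdistrib
        inner_add_right u_def[symmetric] es)
  have p: "0 < u + 1 / u" using u by (simp add: add_pos_pos)
  have "(1 / u * q A) * (u + 1 / u) \<le> q A + q B"
    using AB(1) u by (simp add: field_simps)
  moreover have "q A + q B \<le> (u * q A) * (u + 1 / u)"
    using AB(2) u by (simp add: field_simps)
  ultimately have "1 / u * q A \<le> q (thompson_mid s A B) \<and> q (thompson_mid s A B) \<le> u * q A"
    unfolding mid using p by (simp only: pos_le_divide_eq pos_divide_le_eq)
  then show "exp (- (s / 2)) * (x \<bullet> (A *v x)) \<le> x \<bullet> (thompson_mid s A B *v x) \<and>
      x \<bullet> (thompson_mid s A B *v x) \<le> exp (s / 2) * (x \<bullet> (A *v x))"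
    unfolding q_def es u_def .
qed

text \<open>Order bounds compose: the factors multiply, so the exponents add.\<close>

lemma thompson_dist_triangle:
  assumes A: "pos_def A" and X: "pos_def X" and B: "pos_def B"
  shows "thompson_dist A B \<le> thompson_dist A X + thompson_dist X B"
  unfolding thompson_dist_le_iff[OF A B]
proof (intro allI)
  fix x
  let ?a = "thompson_dist A X" and ?b = "thompson_dist X B"
  have 1: "exp (- ?a) * (x \<bullet> (A *v x)) \<le> x \<bullet> (X *v x)" "x \<bullet> (X *v x) \<le> exp ?a * (x \<bullet> (A *v x))"
    using thompson_dist_le_iff[OF A X] by blast+
  have 2: "exp (- ?b) * (x \<bullet> (X *v x)) \<le> x \<bullet> (B *v x)" "x \<bullet> (B *v x) \<le> exp ?b * (x \<bullet> (X *v x))"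
    using thompson_dist_le_iff[OF X B] by blast+
  have "exp (- ?b) * (exp (- ?a) * (x \<bullet> (A *v x))) \<le> x \<bullet> (B *v x)"
    by (rule order_trans[OF mult_left_mono[OF 1(1)] 2(1)]) simp
  moreover have "x \<bullet> (B *v x) \<le> exp ?b * (exp ?a * (x \<bullet> (A *v x)))"
    by (rule order_trans[OF 2(2) mult_left_mono[OF 1(2)]]) simp
  ultimately show "exp (- (?a + ?b)) * (x \<bullet> (A *v x)) \<le> x \<bullet> (B *v x) \<and>
      x \<bullet> (B *v x) \<le> exp (?a + ?b) * (x \<bullet> (A *v x))"
    by (simp add: exp_add exp_diff exp_minus field_simps)
qed

text \<open>Recasts the matrix constraints as distance bounds, so that a solution minimises the
  largest distance to the data.\<close>

lemma feasible_iff: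
  assumes "\<And>i. i \<in> {1..N} \<Longrightarrow> pos_def (Y i)"
  shows "feasible N Y X t \<longleftrightarrow> pos_def X \<and> (\<forall>i\<in>{1..N}. thompson_dist (Y i) X \<le> t)"
  using assms by (auto simp: feasible_def thompson_dist_le_iff_loewner)

section \<open>The optimal radius when two matrices are active\<close>

theorem proposition3p16:
  fixes Y :: "nat \<Rightarrow> complex^'n^'n" and N :: nat
    and X :: "complex^'n^'n" and t :: real
  assumes "N \<ge> 2"
    and "\<And>i. i \<in> {1..N} \<Longrightarrow> pos_def (Y i)"
    and "is_solution N Y X t"
    and "card {j \<in> {1..N}. active Y X t j} = 2"
  shows "t = 1 / 2 * thompson_diam N Y"
proof -
  note Y = assms(2)
  have feas: "feasible N Y X' t' \<longleftrightarrow> pos_def X' \<and> (\<forall>i\<in>{1..N}. thompson_dist (Y i) X' \<le> t')" for X' t'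
    by (rule feasible_iff) (rule Y)
  have X: "pos_def X" and Xt: "\<And>i. i \<in> {1..N} \<Longrightarrow> thompson_dist (Y i) X \<le> t"
    and opt: "\<And>X' t'. feasible N Y X' t' \<Longrightarrow> t \<le> t'"
    using assms(3) by (auto simp: is_solution_def feas)
  obtain j k where jk: "{j \<in> {1..N}. active Y X t j} = {j, k}"
    using assms(4) by (auto simp: card_2_iff)
  then have j: "j \<in> {1..N}" and k: "k \<in> {1..N}" by blast+
  have inactive: "thompson_dist (Y i) X < t" if "i \<in> {1..N}" "i \<noteq> j" "i \<noteq> k" for i
  proof -
    have "thompson_dist X (Y i) \<noteq> t" using that jk unfolding active_def by blast
    then show ?thesis using Xt[OF that(1)] thompson_dist_commute[OF Y[OF that(1)] X] by simp
  qed
  define D where "D = {thompson_dist (Y i) (Y j) | i j. i \<in> {1..N} \<and> j \<in> {1..N}}"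
  have "D = (\<Union>i\<in>{1..N}. (\<lambda>j. thompson_dist (Y i) (Y j)) ` {1..N})"
    unfolding D_def by blast
  then have fin: "finite D" by simp
  have inD: "thompson_dist (Y j) (Y k) \<in> D" using j k unfolding D_def by blast
  \<comment> \<open>Any two data matrices are joined through \<open>X\<close>, at distance at most
    \<open>t\<close> from each.\<close>
  have "thompson_diam N Y \<le> 2 * t"
    unfolding thompson_diam_def D_def[symmetric]
  proof (rule Max.boundedI[OF fin])
    show "D \<noteq> {}" using inD by auto
    fix a assume "a \<in> D"
    then obtain i l where il: "i \<in> {1..N}" "l \<in> {1..N}" "a = thompson_dist (Y i) (Y l)"
      by (auto simp: D_def)
    show "a \<le> 2 * t"
      using thompson_dist_triangle[OF Y[OF il(1)] X Y[OF il(2)]] Xt[OF il(1)] Xt[OF il(2)]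
        thompson_dist_commute[OF Y[OF il(2)] X] il(3) by simp
  qed
  moreover have "2 * t \<le> thompson_dist (Y j) (Y k)"
  proof (rule ccontr)
    define s where "s = thompson_dist (Y j) (Y k)"
    assume "\<not> 2 * t \<le> thompson_dist (Y j) (Y k)"
    then have st: "s / 2 < t" by (simp add: s_def)
    define M where "M = thompson_mid s (Y j) (Y k)"
    have M: "pos_def M" unfolding M_def by (intro pos_def_thompson_mid Y j k)
    have "thompson_dist (Y j) M \<le> s / 2"
      unfolding M_def by (rule thompson_dist_mid) (auto simp: s_def intro!: Y j k)
    moreover have "thompson_dist (Y k) M \<le> s / 2"
      unfolding M_def thompson_mid_commute[of s "Y j"]
      by (rule thompson_dist_mid)
        (use thompson_dist_commute[OF Y[OF j] Y[OF k]] in \<open>auto simp: s_def intro!: Y j k\<close>)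
    \<comment> \<open>Inactive matrices have slack at \<open>X\<close>, the two active ones at
      \<open>M\<close>. This is the alternative required by
      \<open>eventually_segment_bounds\<close>.\<close>
    ultimately have "thompson_dist (Y i) X < t \<or> thompson_dist (Y i) M < t" if "i \<in> {1..N}" for i
      using inactive[OF that] st by fastforce
    \<comment> \<open>As there are finitely many indices, one small \<open>e\<close> works for all
      of them; it is also taken below 1 to keep the segment point positive definite.\<close>
    then have "\<forall>\<^sub>F e in at_right 0. \<forall>i\<in>{1..N}.
        (1 - e) * exp (thompson_dist (Y i) X) + e * exp (thompson_dist (Y i) M) < exp t \<and>
        exp (- t) < (1 - e) * exp (- thompson_dist (Y i) X) + e * exp (- thompson_dist (Y i) M)"
      by (intro eventually_ball_finite ballI eventually_segment_bounds Xt) auto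
    moreover have "\<forall>\<^sub>F e in at_right (0::real). e \<in> {0<..<1}"
      by (rule eventually_at_right_real) simp
    ultimately obtain e where e: "e \<in> {0<..<1}" and bounds: "\<And>i. i \<in> {1..N} \<Longrightarrow>
        (1 - e) * exp (thompson_dist (Y i) X) + e * exp (thompson_dist (Y i) M) < exp t \<and>
        exp (- t) < (1 - e) * exp (- thompson_dist (Y i) X) + e * exp (- thompson_dist (Y i) M)"
      using eventually_happens'[OF trivial_limit_at_right_real eventually_conj] by blast
    define Z where "Z = (1 - e) *\<^sub>R X + e *\<^sub>R M"
    have Z: "pos_def Z" unfolding Z_def using e X M by (intro pos_def_add pos_def_scaleR) auto
    have less: "thompson_dist (Y i) Z < t" if "i \<in> {1..N}" for i
      unfolding Z_def using bounds[OF that] e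
      by (intro thompson_dist_segment_less Y[OF that] X M) auto
    \<comment> \<open>The largest distance from \<open>Z\<close> is an admissible value for
      \<open>Z\<close>. Being a maximum of finitely many numbers below \<open>t\<close>, it is
      itself below \<open>t\<close>, against optimality.\<close>
    let ?t' = "Max ((\<lambda>i. thompson_dist (Y i) Z) ` {1..N})"
    have "feasible N Y Z ?t'" unfolding feas using Z by auto
    moreover have "?t' < t" using less j by (subst Max_less_iff) auto
    ultimately show False using opt by fastforce
  qed
  moreover have "thompson_dist (Y j) (Y k) \<le> thompson_diam N Y"
    unfolding thompson_diam_def D_def[symmetric] by (rule Max_ge[OF fin inD])
  ultimately show ?thesis by simp
qed

end
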